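(* Let $(A(0),A'(0))\in\mathrm{SL}(3,\mathbb{R})\times\mathbb{M}^3$ satisfy $\operatorname{tr}A'(0)A(0)^{-1}=0$, and let $A\in C(\mathbb{R},\mathrm{SL}(3,\mathbb{R}))\cap C^\infty(\mathbb{R},\mathbb{M}^3)$ be the (unique) global solution of $$A''(t)=\frac{\operatorname{tr}(A'(t)A(t)^{-1})^2}{\operatorname{tr}(A(t)^{-\top}A(t)^{-1})}\,A(t)^{-\top}$$ with these initial data. Let $B=\{y\in\mathbb{R}^3:|y|<1\}$, $\Omega_t=A(t)B$ and $\mathcal{C}=\{(t,x):t\in\mathbb{R},\ x\in\Omega_t\}$. Then the pair $$u(t,x)=A'(t)A(t)^{-1}x,\qquad p(t,x)=\frac12\,\frac{\operatorname{tr}(A'(t)A(t)^{-1})^2}{\operatorname{tr}A(t)^{-\top}A(t)^{-1}}\,\bigl[1-|A(t)^{-1}x|^2\bigr]$$ solves the incompressible Euler equations $$D_tu+\nabla p=0,\qquad \nabla\cdot u=0$$ in $\mathcal{C}$, together with the boundary conditions $$\eta(t,x)\cdot(1,u(t,x))=0,\qquad p(t,x)=0$$ on the lateral boundary $\mathcal{B}=\{(t,x):t\in\mathbb{R},\ x\in\partial\Omega_t\}$. If, in addition, the curvature $$\kappa(t)=\frac{\operatorname{tr}(A'(t)A(t)^{-1})^2}{2E_K(0)\,(\operatorname{tr}A(t)^{-\top}A(t)^{-1})^{1/2}},\qquad E_K(0)=\tfrac12\operatorname{tr}A'(0)A'(0)^\top>0,$$ is positive, then also $D_np(t,x)<0$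 on $\mathcal{B}$.
   Context: $\mathbb{M}^3$ is the space of real $3\times3$ matrices, $\mathrm{SL}(3,\mathbb{R})=\{A\in\mathbb{M}^3:\det A=1\}$, $A^{-\top}=(A^{-1})^\top$. For a matrix $M$, $\operatorname{tr}(M)^2$ as written above means $\operatorname{tr}(M^2)$. $D_t=\partial_t+u\cdot\nabla$ is the material derivative ($\nabla$ is the gradient in $x$). $\eta=(\eta_t,\eta_x)\in\mathbb{R}\times\mathbb{R}^3$ denotes a normal to $\mathcal{B}$, and $D_np(t,x)$ is the derivative of $p(t,\cdot)$ in the direction of the unit outward normal to $\partial\Omega_t$ at $x\in\partial\Omega_t$. It is known that the ODE has a unique global solution for all such initial data. *)

theory Defs
  imports "HOL-Analysis.Analysis"
begin

definition SL3 :: "(real^3^3) set" where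
  "SL3 = {M. det M = 1}"

definition ddt :: "(real \<Rightarrow> 'b::real_normed_vector) \<Rightarrow> real \<Rightarrow> 'b" where
  "ddt f = (\<lambda>t. vector_derivative f (at t))"

definition C_infinity :: "(real \<Rightarrow> 'b::real_normed_vector) \<Rightarrow> bool" where
  "C_infinity f \<longleftrightarrow> (\<forall>n t. (ddt ^^ n) f differentiable (at t))"

definition partial_deriv :: "'n::finite \<Rightarrow> (real^'n \<Rightarrow> 'b::real_normed_vector) \<Rightarrow> real^'n \<Rightarrow> 'b" where
  "partial_deriv i f x = frechet_derivative f (at x) (axis i 1)"

definition grad :: "(real^'n::finite \<Rightarrow> real) \<Rightarrow> real^'n \<Rightarrow> real^'n" where
  "grad f x = (\<chi> i. partial_deriv i f x)"

definition divergence :: "(real^'n::finite \<Rightarrow> real^'n) \<Rightarrow> real^'n \<Rightarrow> real" where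
  "divergence v x = (\<Sum>i\<in>UNIV. partial_deriv i (\<lambda>y. v y $ i) x)"

definition material_deriv ::
    "(real \<Rightarrow> real^'n::finite \<Rightarrow> real^'n) \<Rightarrow> (real \<Rightarrow> real^'n \<Rightarrow> 'b::real_normed_vector)
     \<Rightarrow> real \<Rightarrow> real^'n \<Rightarrow> 'b" where
  "material_deriv u w t x =
     ddt (\<lambda>s. w s x) t + (\<Sum>i\<in>UNIV. (u t x $ i) *\<^sub>R partial_deriv i (w t) x)"

text \<open>
  Joint differentiability is required explicitly: the derivative operators above are total and
  carry no information at points where the derivative does not exist.
\<close>

definition solves_incompressible_Euler_on ::
    "(real \<times> (real^'n::finite)) set \<Rightarrow> (real \<Rightarrow> real^'n \<Rightarrow> real^'n) \<Rightarrow> (real \<Rightarrow> real^'n \<Rightarrow> real) \<Rightarrow> bool" where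
  "solves_incompressible_Euler_on C u p \<longleftrightarrow>
     (\<forall>(t, x)\<in>C.
        (\<lambda>(s, y). u s y) differentiable (at (t, x)) \<and>
        (\<lambda>(s, y). p s y) differentiable (at (t, x)) \<and>
        material_deriv u u t x + grad (p t) x = 0 \<and>
        divergence (u t) x = 0)"

text \<open>
  Velocities at \<open>x\<close> of curves running in \<open>S\<close>. For a \<open>C\<^sup>1\<close> hypersurface \<open>S\<close> this is the tangent
  space at \<open>x\<close>, and the orthogonal complement is the line of normals.
\<close>

definition tangent_vectors :: "'a::euclidean_space set \<Rightarrow> 'a \<Rightarrow> 'a set" where
  "tangent_vectors S x =
     {v. \<exists>\<gamma>::real \<Rightarrow> 'a. \<gamma> 0 = x \<and> (\<forall>\<^sub>F s in nhds 0. \<gamma> s \<in> S) \<and> (\<gamma> has_vector_derivative v) (at 0)}"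

definition normal_vectors :: "'a::euclidean_space set \<Rightarrow> 'a \<Rightarrow> 'a set" where
  "normal_vectors S x = (tangent_vectors S x)\<^sup>\<bottom>"

definition outward_unit_normal :: "'a::euclidean_space set \<Rightarrow> 'a \<Rightarrow> 'a" where
  "outward_unit_normal \<Omega> x =
     (THE n. n \<in> normal_vectors (frontier \<Omega>) x \<and> norm n = 1 \<and>
             (\<forall>\<^sub>F s in at_right 0. x + s *\<^sub>R n \<notin> closure \<Omega>))"

definition normal_deriv :: "'a::euclidean_space set \<Rightarrow> ('a \<Rightarrow> real) \<Rightarrow> 'a \<Rightarrow> real" where
  "normal_deriv \<Omega> f x = deriv (\<lambda>s. f (x + s *\<^sub>R outward_unit_normal \<Omega> x)) 0"

definition velocity_gradient :: "(real \<Rightarrow> real^3^3) \<Rightarrow> real \<Rightarrow> real^3^3" where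
  "velocity_gradient A t = ddt A t ** matrix_inv (A t)"

text \<open>
  The square is the trace of the squared matrix. It is written with \<open>**\<close> because \<open>*\<close> and \<open>^\<close>
  act componentwise on the matrix type.
\<close>

definition trace_sq :: "(real \<Rightarrow> real^3^3) \<Rightarrow> real \<Rightarrow> real" where
  "trace_sq A t = trace (velocity_gradient A t ** velocity_gradient A t)"

definition trace_inv :: "(real \<Rightarrow> real^3^3) \<Rightarrow> real \<Rightarrow> real" where
  "trace_inv A t = trace (transpose (matrix_inv (A t)) ** matrix_inv (A t))"

definition fluid_domain :: "(real \<Rightarrow> real^3^3) \<Rightarrow> real \<Rightarrow> (real^3) set" where
  "fluid_domain A t = (\<lambda>y. A t *v y) ` ball 0 1"

definition fluid_spacetime :: "(real \<Rightarrow> real^3^3) \<Rightarrow> (real \<times> (real^3)) set" where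
  "fluid_spacetime A = {(t, x). x \<in> fluid_domain A t}"

definition lateral_boundary :: "(real \<Rightarrow> real^3^3) \<Rightarrow> (real \<times> (real^3)) set" where
  "lateral_boundary A = {(t, x). x \<in> frontier (fluid_domain A t)}"

definition affine_velocity :: "(real \<Rightarrow> real^3^3) \<Rightarrow> real \<Rightarrow> real^3 \<Rightarrow> real^3" where
  "affine_velocity A t x = velocity_gradient A t *v x"

definition affine_pressure :: "(real \<Rightarrow> real^3^3) \<Rightarrow> real \<Rightarrow> real^3 \<Rightarrow> real" where
  "affine_pressure A t x =
     1/2 * (trace_sq A t / trace_inv A t) * (1 - (norm (matrix_inv (A t) *v x))\<^sup>2)"

definition kinetic_energy :: "(real \<Rightarrow> real^3^3) \<Rightarrow> real \<Rightarrow> real" where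
  "kinetic_energy A t = 1/2 * trace (ddt A t ** transpose (ddt A t))"

definition curvature :: "(real \<Rightarrow> real^3^3) \<Rightarrow> real \<Rightarrow> real" where
  "curvature A t = trace_sq A t / (2 * kinetic_energy A 0 * sqrt (trace_inv A t))"

end

theory Submission
  imports Defs
begin

text \<open>
  Write \<open>B\<close> for \<open>A\<^sup>-\<^sup>1\<close>, \<open>G\<close> for the velocity gradient \<open>A' B\<close> and \<open>c\<close> for the scalar factor on
  the right of the differential equation. Since \<open>u\<close> is linear in \<open>x\<close> with matrix \<open>G\<close>, its
  material derivative is linear with matrix \<open>G' + G\<^sup>2\<close>. Differentiating \<open>G A = A'\<close> gives
  \<open>G' + G\<^sup>2 = A'' B\<close>, and the differential equation turns this into \<open>c B\<^sup>\<top> B\<close>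
  (\<open>has_vector_derivative_G\<close>). The pressure is the quadratic function of \<open>x\<close> whose gradient is
  \<open>- c B\<^sup>\<top> B x\<close>, which is the momentum equation.

  The divergence of \<open>u\<close> is \<open>tr G\<close>. The factor \<open>c\<close> is exactly the value for which
  \<open>(tr G)' = c tr (B\<^sup>\<top> B) - tr (G\<^sup>2)\<close> vanishes, so \<open>tr G\<close> keeps its initial value zero
  (\<open>trace_G\<close>).

  On the boundary the particle path \<open>s \<mapsto> (s, A(s) B(t) x)\<close> stays in the lateral boundary, hence
  its velocity \<open>(1, u)\<close> is tangent there and every normal annihilates it. The pressure vanishes
  because \<open>\<partial>\<Omega>\<^sub>t\<close> is the ellipsoid \<open>|B x| = 1\<close>. Its outward unit normal is
  \<open>B\<^sup>\<top> B x\<close> divided by its length (\<open>outward_unit_normal_ellipsoid\<close>), so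
  \<open>D\<^sub>n p = - c |B\<^sup>\<top> B x|\<close>, and \<open>c\<close> has the sign of the curvature when the initial
  kinetic energy is positive.
\<close>

section \<open>Matrix calculus\<close>

lemma
  fixes M :: "'a::field^'n^'n"
  assumes "det M \<noteq> 0"
  shows matrix_inv_right: "M ** matrix_inv M = mat 1"
    and matrix_inv_left: "matrix_inv M ** M = mat 1"
proof -
  have "\<exists>N. M ** N = mat 1 \<and> N ** M = mat 1"
    using assms by (simp add: invertible_det_nz[symmetric] invertible_def)
  from someI_ex[OF this] show "M ** matrix_inv M = mat 1" "matrix_inv M ** M = mat 1"
    by (simp_all add: matrix_inv_def)
qed

lemma bounded_bilinear_matrix_mult:
  "bounded_bilinear (\<lambda>(M::real^'n^'m) (N::real^'k^'n). M ** N)"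
proof -
  have "bilinear (\<lambda>(M::real^'n^'m) (N::real^'k^'n). M ** N)"
    unfolding bilinear_def
    by (auto intro!: linearI simp: matrix_matrix_mult_def vec_eq_iff sum.distrib
        sum_distrib_left algebra_simps)
  then show ?thesis by (simp add: bilinear_conv_bounded_bilinear)
qed

lemma bounded_bilinear_matrix_vector_mult:
  "bounded_bilinear (\<lambda>(M::real^'n^'m) (x::real^'n). M *v x)"
proof -
  have "bilinear (\<lambda>(M::real^'n^'m) (x::real^'n). M *v x)"
    unfolding bilinear_def
    by (auto intro!: linearI simp: matrix_vector_mult_add_rdistrib matrix_vector_right_distrib
        matrix_vector_mult_scaleR scaleR_matrix_vector_assoc)
  then show ?thesis by (simp add: bilinear_conv_bounded_bilinear)
qed

lemma bounded_linear_trace: "bounded_linear (trace :: real^'n^'n \<Rightarrow> real)"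
proof -
  have "linear (trace :: real^'n^'n \<Rightarrow> real)"
    by (intro linearI) (simp_all add: trace_def sum.distrib sum_distrib_left)
  then show ?thesis by (simp add: linear_conv_bounded_linear)
qed

lemma bounded_linear_transpose: "bounded_linear (transpose :: real^'n^'m \<Rightarrow> real^'m^'n)"
proof -
  have "linear (transpose :: real^'n^'m \<Rightarrow> real^'m^'n)"
    by (intro linearI) (simp_all add: transpose_def vec_eq_iff)
  then show ?thesis by (simp add: linear_conv_bounded_linear)
qed

lemma differentiable_bounded_bilinear:
  assumes "bounded_bilinear h"
    and "f differentiable (at x within S)" "g differentiable (at x within S)"
  shows "(\<lambda>y. h (f y) (g y)) differentiable (at x within S)"
  using assms bounded_bilinear.FDERIV[OF assms(1)] unfolding differentiable_def by blast

lemma differentiable_bounded_linear: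
  assumes "bounded_linear h" "f differentiable F"
  shows "(\<lambda>y. h (f y)) differentiable F"
  using assms bounded_linear.has_derivative[OF assms(1)] unfolding differentiable_def by blast

lemmas differentiable_matrix_mult =
  differentiable_bounded_bilinear[OF bounded_bilinear_matrix_mult]
lemmas differentiable_matrix_vector_mult =
  differentiable_bounded_bilinear[OF bounded_bilinear_matrix_vector_mult]

lemma differentiable_vecI:
  fixes f :: "'a::real_normed_vector \<Rightarrow> 'b::euclidean_space^'n"
  assumes "\<And>i. (\<lambda>x. f x $ i) differentiable (at a)"
  shows "f differentiable (at a)"
proof -
  have "(\<lambda>x. \<Sum>i\<in>UNIV. axis i (f x $ i)) differentiable (at a)"
  proof (rule differentiable_sum, simp, rule ballI)
    fix i :: 'n
    have "linear (\<lambda>y::'b. axis i y :: 'b^'n)"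
      by (intro linearI) (auto simp: axis_def vec_eq_iff)
    then show "(\<lambda>x. axis i (f x $ i)) differentiable (at a)"
      by (intro differentiable_bounded_linear[OF _ assms]) (simp add: linear_conv_bounded_linear)
  qed
  moreover have "(\<Sum>i\<in>UNIV. axis i (f x $ i)) = f x" for x
    unfolding vec_eq_iff sum_component by (simp add: axis_def)
  ultimately show ?thesis by simp
qed

lemma differentiable_vec_nth:
  assumes "f differentiable F"
  shows "(\<lambda>x. f x $ i) differentiable F"
  by (rule differentiable_bounded_linear[OF bounded_linear_vec_nth assms])

lemma differentiable_prod:
  fixes f :: "'i \<Rightarrow> 'a::real_normed_vector \<Rightarrow> real"
  assumes "\<And>i. i \<in> I \<Longrightarrow> f i differentiable (at a)"
  shows "(\<lambda>x. \<Prod>i\<in>I. f i x) differentiable (at a)"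
  using assms
proof (induction I rule: infinite_finite_induct)
  case (insert i I)
  then have "(\<lambda>x. f i x * (\<Prod>i\<in>I. f i x)) differentiable (at a)"
    by (intro differentiable_mult) auto
  then show ?case using insert.hyps by simp
qed simp_all

lemma differentiable_det:
  fixes M :: "'a::real_normed_vector \<Rightarrow> real^'n^'n"
  assumes "M differentiable (at a)"
  shows "(\<lambda>x. det (M x)) differentiable (at a)"
  unfolding det_def
  by (intro differentiable_sum ballI differentiable_mult differentiable_prod
      differentiable_const differentiable_vec_nth assms finite_permutations) simp

text \<open>
  Cramer's rule expresses each entry of the inverse as a quotient of two determinants.
\<close>

lemma differentiable_matrix_inv:
  fixes M :: "'a::real_normed_vector \<Rightarrow> real^'n^'n"
  assumes M: "M differentiable (at a)" and det: "\<And>x. det (M x) \<noteq> 0"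
  shows "(\<lambda>x. matrix_inv (M x)) differentiable (at a)"
proof (intro differentiable_vecI)
  fix i j :: 'n
  define N where "N x = (\<chi> k l. if l = i then axis j 1 $ k else M x $ k $ l)" for x
  have "M x *v (matrix_inv (M x) *v axis j 1) = axis j 1" for x
    by (simp add: matrix_vector_mul_assoc matrix_inv_right[OF det])
  from this[unfolded cramer[OF det]]
  have "matrix_inv (M x) $ i $ j = det (N x) / det (M x)" for x
    by (simp add: N_def matrix_vector_mult_basis column_def vec_eq_iff)
  moreover have "N differentiable (at a)"
  proof (intro differentiable_vecI)
    show "(\<lambda>x. N x $ k $ l) differentiable (at a)" for k l
      by (cases "l = i") (simp_all add: N_def differentiable_vec_nth M)
  qed
  ultimately show "(\<lambda>x. matrix_inv (M x) $ i $ j) differentiable (at a)"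
    by (simp add: differentiable_divide differentiable_det M det)
qed

lemma inner_matrix_vector_transpose:
  fixes M :: "real^'n^'m"
  shows "(M *v x) \<bullet> y = x \<bullet> (transpose M *v y)"
  by (metis dot_lmul_matrix inner_commute vector_transpose_matrix)

section \<open>Ellipsoids\<close>

lemma linear_image_ball_topology:
  fixes M :: "real^'n^'n"
  assumes "det M \<noteq> 0"
  defines "\<Omega> \<equiv> (\<lambda>y. M *v y) ` ball 0 1"
  shows "closure \<Omega> = {x. norm (matrix_inv M *v x) \<le> 1}"
    and "frontier \<Omega> = {x. norm (matrix_inv M *v x) = 1}"
proof -
  have lin: "linear ((*v) M)" by simp
  have inj: "inj ((*v) M)"
    using assms by (intro inj_matrix_vector_mult) (simp add: invertible_det_nz)
  have img: "(*v) M ` S = {x. matrix_inv M *v x \<in> S}" for S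
  proof safe
    fix x assume "matrix_inv M *v x \<in> S"
    moreover have "x = M *v (matrix_inv M *v x)"
      by (simp add: matrix_vector_mul_assoc matrix_inv_right assms)
    ultimately show "x \<in> (*v) M ` S" by blast
  qed (simp add: matrix_vector_mul_assoc matrix_inv_left assms)
  have cl: "closure \<Omega> = (*v) M ` cball 0 1"
    using closure_injective_linear_image[OF lin inj, of "ball 0 1"] by (simp add: \<Omega>_def)
  moreover have "interior \<Omega> = (*v) M ` ball 0 1"
    using interior_injective_linear_image[OF lin inj, of "ball 0 1"] by (simp add: \<Omega>_def interior_open)
  ultimately show "closure \<Omega> = {x. norm (matrix_inv M *v x) \<le> 1}"
    and "frontier \<Omega> = {x. norm (matrix_inv M *v x) = 1}"
    by (auto simp: frontier_def img)
qed

lemma norm_square_along_line: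
  fixes B :: "real^'n^'m"
  shows "(norm (B *v (x + s *\<^sub>R v)))\<^sup>2 =
    (norm (B *v x))\<^sup>2 + 2 * s * ((B *v x) \<bullet> (B *v v)) + s\<^sup>2 * (norm (B *v v))\<^sup>2"
  unfolding power2_norm_eq_inner matrix_vector_right_distrib matrix_vector_mult_scaleR
    inner_add inner_scaleR_left inner_scaleR_right inner_commute[of "B *v v" "B *v x"]
    power2_eq_square[of s]
  by (simp add: algebra_simps)

text \<open>
  Differentiating \<open>|B \<gamma>(s)|\<^sup>2 = 1\<close> gives one inclusion. For the other, the straight line in a
  direction \<open>v\<close> of the hyperplane is rescaled radially back to the ellipsoid; orthogonality makes
  the scaling factor even in \<open>s\<close>, so it does not change the velocity at \<open>s = 0\<close>.
\<close>

lemma tangent_vectors_ellipsoid: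
  fixes B :: "real^'n^'m"
  assumes x: "norm (B *v x) = 1"
  shows "tangent_vectors {z. norm (B *v z) = 1} x = {v. (B *v x) \<bullet> (B *v v) = 0}"
proof (intro equalityI subsetI; clarsimp)
  fix v assume "v \<in> tangent_vectors {z. norm (B *v z) = 1} x"
  then obtain \<gamma> where \<gamma>: "\<gamma> 0 = x" "\<forall>\<^sub>F s in nhds 0. norm (B *v \<gamma> s) = 1"
      "(\<gamma> has_vector_derivative v) (at 0)"
    by (auto simp: tangent_vectors_def)
  have "((\<lambda>s. B *v \<gamma> s) has_vector_derivative B *v v) (at 0)"
    by (rule bounded_linear.has_vector_derivative[OF matrix_vector_mul_bounded_linear \<gamma>(3)])
  from bounded_bilinear.has_vector_derivative[OF bounded_bilinear_inner this this]
  have d: "((\<lambda>s. (B *v \<gamma> s) \<bullet> (B *v \<gamma> s)) has_vector_derivative 2 * ((B *v x) \<bullet> (B *v v))) (at 0)"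
    by (simp add: \<gamma>(1) inner_commute)
  have "((\<lambda>s. 1::real) has_vector_derivative 2 * ((B *v x) \<bullet> (B *v v))) (at 0)"
  proof (rule iffD1[OF has_vector_derivative_cong_ev d])
    show "\<forall>\<^sub>F s in nhds 0. s \<in> UNIV \<longrightarrow> (B *v \<gamma> s) \<bullet> (B *v \<gamma> s) = 1"
      using \<gamma>(2) by eventually_elim (simp add: dot_square_norm)
  qed (simp_all add: \<gamma>(1) x dot_square_norm)
  then show "(B *v x) \<bullet> (B *v v) = 0"
    using vector_derivative_unique_at[OF _ has_vector_derivative_const] by fastforce
next
  fix v assume orth: "(B *v x) \<bullet> (B *v v) = 0"
  define r where "r s = sqrt (1 + s\<^sup>2 * (norm (B *v v))\<^sup>2)" for s :: real
  define \<gamma> where "\<gamma> s = (1 / r s) *\<^sub>R (x + s *\<^sub>R v)" for s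
  have rpos: "r s > 0" for s by (simp add: r_def add_pos_nonneg)
  have "norm (B *v (x + s *\<^sub>R v)) = r s" for s
  proof -
    have "(norm (B *v (x + s *\<^sub>R v)))\<^sup>2 = 1 + s\<^sup>2 * (norm (B *v v))\<^sup>2"
      using x orth
      by (simp add: norm_square_along_line)
    then show ?thesis unfolding r_def by (intro real_sqrt_unique[symmetric]) simp_all
  qed
  then have "norm (B *v \<gamma> s) = 1" for s
    using rpos[of s] by (simp add: \<gamma>_def matrix_vector_mult_scaleR)
  moreover have "(\<gamma> has_vector_derivative v) (at 0)"
  proof -
    have "((\<lambda>s. 1 / r s) has_real_derivative 0) (at 0)"
      unfolding r_def by (auto intro!: derivative_eq_intros)
    then show ?thesis
      unfolding \<gamma>_def
      by (auto intro!: derivative_eq_intros simp: r_def)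
  qed
  moreover have "\<gamma> 0 = x" by (simp add: \<gamma>_def r_def)
  ultimately show "v \<in> tangent_vectors {z. norm (B *v z) = 1} x"
    unfolding tangent_vectors_def by auto
qed

lemma normal_vectors_ellipsoid:
  fixes B :: "real^'n^'m"
  assumes x: "norm (B *v x) = 1"
  shows "normal_vectors {z. norm (B *v z) = 1} x = span {transpose B *v (B *v x)}"
proof -
  define m where "m = transpose B *v (B *v x)"
  have m: "(B *v x) \<bullet> (B *v v) = v \<bullet> m" for v
    by (simp add: m_def inner_matrix_vector_transpose inner_commute)
  have "tangent_vectors {z. norm (B *v z) = 1} x = (span {m})\<^sup>\<bottom>"
    unfolding tangent_vectors_ellipsoid[OF x] m
    by (auto simp: orthogonal_comp_def orthogonal_def span_singleton inner_commute)
  then show ?thesis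
    by (simp add: normal_vectors_def orthogonal_comp_self m_def)
qed

text \<open>
  There are two unit vectors on the normal line. The sign is decided by
  \<open>|B (x + s v)|\<^sup>2 = 1 + 2 s (v \<bullet> m) + s\<^sup>2 |B v|\<^sup>2\<close>: for small \<open>s > 0\<close> this exceeds one along
  \<open>m\<close> and is below one along \<open>-m\<close>.
\<close>

lemma outward_unit_normal_ellipsoid:
  fixes M :: "real^'n^'n"
  assumes "det M \<noteq> 0"
  defines "B \<equiv> matrix_inv M"
  assumes x: "norm (B *v x) = 1"
  defines "m \<equiv> transpose B *v (B *v x)"
  shows "outward_unit_normal ((\<lambda>y. M *v y) ` ball 0 1) x = m /\<^sub>R norm m"
    and "m \<noteq> 0"
proof -
  have mv: "(B *v x) \<bullet> (B *v v) = v \<bullet> m" for v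
    by (simp add: m_def inner_matrix_vector_transpose inner_commute)
  have "x \<bullet> m = 1" using mv[of x] x by (simp add: dot_square_norm)
  then show m0: "m \<noteq> 0" by auto
  have expand: "(norm (B *v (x + s *\<^sub>R v)))\<^sup>2 = 1 + 2 * s * (v \<bullet> m) + s\<^sup>2 * (norm (B *v v))\<^sup>2" for s v
    using x mv[of v] by (simp add: norm_square_along_line)
  have in_closure: "x + s *\<^sub>R v \<in> closure ((\<lambda>y. M *v y) ` ball 0 1) \<longleftrightarrow>
      2 * s * (v \<bullet> m) + s\<^sup>2 * (norm (B *v v))\<^sup>2 \<le> 0" for s v
    unfolding linear_image_ball_topology(1)[OF assms(1)] B_def[symmetric]
    using expand[of s v] abs_square_le_1[of "norm (B *v (x + s *\<^sub>R v))"] by simp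
  show "outward_unit_normal ((\<lambda>y. M *v y) ` ball 0 1) x = m /\<^sub>R norm m"
    unfolding outward_unit_normal_def linear_image_ball_topology(2)[OF assms(1)] B_def[symmetric]
      normal_vectors_ellipsoid[OF x] in_closure m_def[symmetric]
  proof (rule the_equality, intro conjI)
    show "m /\<^sub>R norm m \<in> span {m}" by (simp add: span_base span_scale)
    show "norm (m /\<^sub>R norm m) = 1" using m0 by simp
    have "(m /\<^sub>R norm m) \<bullet> m > 0" using m0 by simp
    then show "\<forall>\<^sub>F s in at_right 0.
        \<not> 2 * s * ((m /\<^sub>R norm m) \<bullet> m) + s\<^sup>2 * (norm (B *v (m /\<^sub>R norm m)))\<^sup>2 \<le> 0"
      by (intro eventually_at_rightI[of 0 1]) (auto simp: not_le intro!: add_pos_nonneg)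
  next
    fix n assume n: "n \<in> span {m} \<and> norm n = 1 \<and>
      (\<forall>\<^sub>F s in at_right 0. \<not> 2 * s * (n \<bullet> m) + s\<^sup>2 * (norm (B *v n))\<^sup>2 \<le> 0)"
    then obtain k where k: "n = k *\<^sub>R m" by (auto simp: span_singleton)
    have nk: "\<bar>k\<bar> * norm m = 1" using n k by simp
    have "k > 0"
    proof (rule ccontr)
      assume "\<not> k > 0"
      with nk have "k < 0" by (cases "k = 0") auto
      then have neg: "n \<bullet> m < 0" using m0 by (simp add: k mult_neg_pos)
      \<comment> \<open>The linear term is negative and dominates as \<open>s\<close> tends to zero, so the ray enters the
        domain.\<close>
      have "((\<lambda>s. 2 * (n \<bullet> m) + s * (norm (B *v n))\<^sup>2) \<longlongrightarrow> 2 * (n \<bullet> m) + 0 * (norm (B *v n))\<^sup>2)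
          (at_right 0)"
        by (intro tendsto_intros)
      from order_tendstoD(2)[OF this, of 0]
      have "\<forall>\<^sub>F s in at_right 0. 2 * (n \<bullet> m) + s * (norm (B *v n))\<^sup>2 < 0"
        using neg by simp
      moreover have "\<forall>\<^sub>F s in at_right (0::real). 0 < s"
        by (simp add: eventually_at_right_less)
      ultimately have "\<forall>\<^sub>F s in at_right (0::real). False"
        using conjunct2[OF conjunct2[OF n]]
      proof eventually_elim
        case (elim s)
        then have "s * (2 * (n \<bullet> m) + s * (norm (B *v n))\<^sup>2) < 0" by (simp add: mult_pos_neg)
        with elim show False by (simp add: algebra_simps power2_eq_square)
      qed
      then show False by simp
    qed
    with nk m0 have "k = inverse (norm m)" by (simp add: field_simps)
    then show "n = m /\<^sub>R norm m" using k by simp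
  qed
qed

section \<open>Linear velocity fields and quadratic pressures\<close>

lemma sum_partial_deriv:
  assumes "f differentiable (at x)"
  shows "(\<Sum>i\<in>UNIV. (v $ i) *\<^sub>R partial_deriv i f x) = frechet_derivative f (at x) v"
proof -
  interpret D: bounded_linear "frechet_derivative f (at x)"
    using assms by (simp add: frechet_derivative_works has_derivative_bounded_linear)
  have "frechet_derivative f (at x) (\<Sum>i\<in>UNIV. (v $ i) *\<^sub>R axis i 1) =
      (\<Sum>i\<in>UNIV. (v $ i) *\<^sub>R partial_deriv i f x)"
    by (simp add: D.sum D.scaleR partial_deriv_def)
  then show ?thesis by (simp add: basis_expansion flip: scalar_mult_eq_scaleR)
qed

lemma material_deriv_linear_field:
  fixes G :: "real \<Rightarrow> real^'n^'n"
  assumes "(G has_vector_derivative G') (at t)"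
  shows "material_deriv (\<lambda>s y. G s *v y) (\<lambda>s y. G s *v y) t x = (G' + G t ** G t) *v x"
proof -
  have "((\<lambda>s. G s *v x) has_vector_derivative G' *v x) (at t)"
    using bounded_bilinear.has_vector_derivative[OF bounded_bilinear_matrix_vector_mult assms
        has_vector_derivative_const] by simp
  moreover have G: "((\<lambda>y. G t *v y) has_derivative (\<lambda>y. G t *v y)) (at x)"
    by (rule bounded_linear_imp_has_derivative) simp
  ultimately show ?thesis
    unfolding material_deriv_def ddt_def
    by (simp add: sum_partial_deriv[OF differentiableI[OF G]] frechet_derivative_at[OF G, symmetric]
        vector_derivative_at matrix_vector_mult_add_rdistrib matrix_vector_mul_assoc)
qed

lemma divergence_linear_field:
  fixes G :: "real^'n^'n"
  shows "divergence (\<lambda>y. G *v y) x = trace G"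
proof -
  have "((\<lambda>y. (G *v y) $ i) has_derivative (\<lambda>y. (G *v y) $ i)) (at x)" for i
    by (rule bounded_linear_imp_has_derivative)
      (rule bounded_linear_compose[OF bounded_linear_vec_nth matrix_vector_mul_bounded_linear])
  from frechet_derivative_at[OF this]
  have "frechet_derivative (\<lambda>y. (G *v y) $ i) (at x) = (\<lambda>y. (G *v y) $ i)" for i by simp
  then show ?thesis
    by (simp add: divergence_def partial_deriv_def trace_def matrix_vector_mult_basis column_def)
qed

lemma has_derivative_quadratic_profile:
  fixes B :: "real^'n^'m"
  shows "((\<lambda>y. 1/2 * c * (1 - (norm (B *v y))\<^sup>2)) has_derivative
    (\<lambda>v. - c * (v \<bullet> (transpose B *v (B *v x))))) (at x)"
proof -
  have "((\<lambda>y. 1/2 * c * (1 - (B *v y) \<bullet> (B *v y))) has_derivative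
    (\<lambda>v. 1/2 * c * (0 - ((B *v x) \<bullet> (B *v v) + (B *v v) \<bullet> (B *v x))))) (at x)"
    by (intro derivative_intros bounded_linear_imp_has_derivative matrix_vector_mul_bounded_linear)
  moreover have "(B *v v) \<bullet> (B *v x) = v \<bullet> (transpose B *v (B *v x))" for v
    by (rule inner_matrix_vector_transpose)
  ultimately show ?thesis
    unfolding power2_norm_eq_inner inner_commute[of "B *v x" "B *v _"] by simp
qed

lemma grad_quadratic_profile:
  fixes B :: "real^'n^'m"
  shows "grad (\<lambda>y. 1/2 * c * (1 - (norm (B *v y))\<^sup>2)) x = - c *\<^sub>R (transpose B *v (B *v x))"
  unfolding grad_def partial_deriv_def frechet_derivative_at[OF has_derivative_quadratic_profile, symmetric]
  by (simp add: vec_eq_iff inner_axis')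

section \<open>Affine motions of the unit ball\<close>

locale affine_Euler_flow =
  fixes A :: "real \<Rightarrow> real^3^3"
  assumes det_A: "\<And>t. det (A t) = 1"
    and smooth: "C_infinity A"
    and ode: "\<And>t. ddt (ddt A) t = (trace_sq A t / trace_inv A t) *\<^sub>R transpose (matrix_inv (A t))"
    and trace_initial: "trace (velocity_gradient A 0) = 0"
begin

abbreviation "B t \<equiv> matrix_inv (A t)"
abbreviation "G \<equiv> velocity_gradient A"
abbreviation "c t \<equiv> trace_sq A t / trace_inv A t"

lemma det_nonzero: "det (A t) \<noteq> 0"
  by (simp add: det_A)

lemma has_vector_derivative_A: "(A has_vector_derivative ddt A t) (at t)"
  and has_vector_derivative_ddt_A: "(ddt A has_vector_derivative ddt (ddt A) t) (at t)"
proof -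
  have "(ddt ^^ n) A differentiable (at t)" for n
    using smooth by (simp add: C_infinity_def)
  from this[of 0] this[of 1]
  have "A differentiable (at t)" "ddt A differentiable (at t)" by simp_all
  then show "(A has_vector_derivative ddt A t) (at t)"
    "(ddt A has_vector_derivative ddt (ddt A) t) (at t)"
    by (simp_all add: vector_derivative_works[symmetric] ddt_def)
qed

lemma differentiable_B: "B differentiable (at t)"
  by (intro differentiable_matrix_inv det_nonzero)
    (rule differentiableI_vector[OF has_vector_derivative_A])

lemma differentiable_G: "G differentiable (at t)"
  unfolding velocity_gradient_def[abs_def]
  by (intro differentiable_matrix_mult differentiable_B
      differentiableI_vector[OF has_vector_derivative_ddt_A])

lemma G_mult_A: "G t ** A t = ddt A t"
  by (simp add: velocity_gradient_def matrix_mul_assoc[symmetric] matrix_inv_left[OF det_nonzero])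

text \<open>
  Once \<open>G\<close> is known to be differentiable, the product rule for \<open>G A = A'\<close> can be solved for
  \<open>G'\<close>; this bypasses the derivative of the inverse.
\<close>

lemma has_vector_derivative_G:
  "(G has_vector_derivative c t *\<^sub>R (transpose (B t) ** B t) - G t ** G t) (at t)"
proof -
  obtain G' where G': "(G has_vector_derivative G') (at t)"
    using differentiable_G vector_derivative_works by blast
  have "((\<lambda>s. G s ** A s) has_vector_derivative G t ** ddt A t + G' ** A t) (at t)"
    by (rule bounded_bilinear.has_vector_derivative[OF bounded_bilinear_matrix_mult G'
          has_vector_derivative_A])
  then have "(ddt A has_vector_derivative G t ** ddt A t + G' ** A t) (at t)"
    by (simp add: G_mult_A)
  then have "G t ** ddt A t + G' ** A t = ddt (ddt A) t"
    using vector_derivative_unique_at has_vector_derivative_ddt_A by blast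
  then have "G' ** A t = c t *\<^sub>R transpose (B t) - G t ** ddt A t"
    by (simp add: ode algebra_simps)
  then have "(G' ** A t) ** B t = (c t *\<^sub>R transpose (B t) - G t ** ddt A t) ** B t" by simp
  then have "G' = c t *\<^sub>R (transpose (B t) ** B t) - G t ** G t"
    by (simp add: matrix_mul_assoc[symmetric] matrix_inv_right[OF det_nonzero]
        bounded_bilinear.diff_left[OF bounded_bilinear_matrix_mult]
        bounded_bilinear.scaleR_left[OF bounded_bilinear_matrix_mult]
        velocity_gradient_def)
  with G' show ?thesis by simp
qed

text \<open>
  The trace is the squared Frobenius norm of the inverse, an invertible matrix.
\<close>

lemma trace_inv_pos: "trace_inv A t > 0"
proof -
  have eq: "trace_inv A t = (\<Sum>i\<in>UNIV. \<Sum>k\<in>UNIV. (B t $ k $ i)\<^sup>2)"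
    by (simp add: trace_inv_def trace_def matrix_matrix_mult_def transpose_def power2_eq_square)
  have "trace_inv A t \<noteq> 0"
  proof
    assume "trace_inv A t = 0"
    then have "B t $ k $ i = 0" for i k
      by (simp add: eq sum_nonneg_eq_0_iff sum_nonneg)
    then have "B t = 0" by (simp add: vec_eq_iff)
    then have "mat 1 = (0::real^3^3)" using matrix_inv_right[OF det_nonzero, of t] by simp
    then have "(mat 1 :: real^3^3) $ 1 $ 1 = 0" by simp
    then show False by (simp add: mat_def)
  qed
  moreover have "trace_inv A t \<ge> 0" by (simp add: eq sum_nonneg)
  ultimately show ?thesis by simp
qed

text \<open>
  By the choice of \<open>c\<close> the two traces in the derivative of \<open>tr G\<close> cancel, so \<open>tr G\<close> is constant.
\<close>

lemma trace_G: "trace (G t) = 0"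
proof -
  have "((\<lambda>t. trace (G t)) has_vector_derivative
      trace (c t *\<^sub>R (transpose (B t) ** B t) - G t ** G t)) (at t)" for t
    by (rule bounded_linear.has_vector_derivative[OF bounded_linear_trace has_vector_derivative_G])
  moreover have "trace (c t *\<^sub>R (transpose (B t) ** B t) - G t ** G t) = 0" for t
    using trace_inv_pos[of t]
    by (simp add: trace_sub linear_cmul[OF bounded_linear.linear[OF bounded_linear_trace]]
        flip: trace_inv_def trace_sq_def)
  ultimately have "((\<lambda>t. trace (G t)) has_derivative (\<lambda>h. 0)) (at t within UNIV)" for t
    by (simp add: has_vector_derivative_def)
  from has_derivative_zero_unique[OF convex_UNIV this UNIV_I UNIV_I, of t 0]
  show ?thesis using trace_initial by simp
qed

lemma momentum_equation:
  "material_deriv (affine_velocity A) (affine_velocity A) t x + grad (affine_pressure A t) x = 0"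
proof -
  have "material_deriv (affine_velocity A) (affine_velocity A) t x
      = (c t *\<^sub>R (transpose (B t) ** B t)) *v x"
    using material_deriv_linear_field[OF has_vector_derivative_G, of t x]
    by (simp add: affine_velocity_def[abs_def])
  also have "\<dots> = c t *\<^sub>R (transpose (B t) *v (B t *v x))"
    by (simp add: matrix_vector_mul_assoc scaleR_matrix_vector_assoc)
  finally show ?thesis
    using grad_quadratic_profile[of "c t" "B t" x] by (simp add: affine_pressure_def[abs_def])
qed

lemma differentiable_time_dependent:
  fixes f :: "real \<Rightarrow> 'b::real_normed_vector"
  assumes "f differentiable (at t)"
  shows "(\<lambda>z. f (fst z)) differentiable (at (t, x))"
  using assms
  by (intro differentiable_compose[of f fst]) (simp_all add: bounded_linear_imp_differentiable bounded_linear_fst)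

lemma differentiable_velocity: "(\<lambda>(s, y). affine_velocity A s y) differentiable (at (t, x))"
  unfolding affine_velocity_def[abs_def] case_prod_beta
  by (intro differentiable_matrix_vector_mult differentiable_time_dependent differentiable_G
      bounded_linear_imp_differentiable bounded_linear_snd)

lemma differentiable_pressure: "(\<lambda>(s, y). affine_pressure A s y) differentiable (at (t, x))"
proof -
  have "trace_sq A differentiable (at t)" "trace_inv A differentiable (at t)"
    unfolding trace_sq_def[abs_def] trace_inv_def[abs_def]
    by (intro differentiable_bounded_linear[OF bounded_linear_trace] differentiable_matrix_mult
        differentiable_G differentiable_B differentiable_bounded_linear[OF bounded_linear_transpose])+
  then have "c differentiable (at t)"
    using trace_inv_pos[of t] by (intro differentiable_divide) auto
  moreover have "(\<lambda>z. B (fst z) *v snd z) differentiable (at (t, x))"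
    by (intro differentiable_matrix_vector_mult differentiable_time_dependent differentiable_B
        bounded_linear_imp_differentiable bounded_linear_snd)
  ultimately show ?thesis
    unfolding affine_pressure_def[abs_def] case_prod_beta power2_norm_eq_inner
    by (intro differentiable_mult differentiable_diff differentiable_const differentiable_inner
        differentiable_time_dependent)
qed

lemma solves_Euler:
  "solves_incompressible_Euler_on C (affine_velocity A) (affine_pressure A)"
proof -
  have "divergence (affine_velocity A t) x = 0" for t x
    using divergence_linear_field[of "G t" x] by (simp add: trace_G affine_velocity_def[abs_def])
  then show ?thesis
    unfolding solves_incompressible_Euler_on_def
    using differentiable_velocity differentiable_pressure momentum_equation by auto
qed

lemma mem_lateral_boundary: "(t, x) \<in> lateral_boundary A \<longleftrightarrow> norm (B t *v x) = 1"
  by (simp add: lateral_boundary_def fluid_domain_def linear_image_ball_topology(2)[OF det_nonzero])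

text \<open>
  The boundary of the domain consists of the same particles at all times, and the space-time path
  of such a particle has velocity \<open>(1, u)\<close>.
\<close>

lemma kinematic_boundary_condition:
  assumes "(t, x) \<in> lateral_boundary A" "\<eta> \<in> normal_vectors (lateral_boundary A) (t, x)"
  shows "\<eta> \<bullet> (1, affine_velocity A t x) = 0"
proof -
  define y where "y = B t *v x"
  define \<gamma> where "\<gamma> s = (t + s, A (t + s) *v y)" for s
  have "\<gamma> 0 = (t, x)"
    by (simp add: \<gamma>_def y_def matrix_vector_mul_assoc matrix_inv_right[OF det_nonzero])
  moreover have "\<gamma> s \<in> lateral_boundary A" for s
    using assms(1)
    by (simp add: \<gamma>_def mem_lateral_boundary matrix_vector_mul_assoc[of "B _"]
        matrix_inv_left[OF det_nonzero] y_def[symmetric])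
  moreover have "(\<gamma> has_vector_derivative (1, affine_velocity A t x)) (at 0)"
  proof -
    have "((\<lambda>s. A (t + s)) has_vector_derivative ddt A t) (at 0)"
      using has_vector_derivative_A[of t]
        vector_diff_chain_at[of "\<lambda>s. t + s" 1 0 A "ddt A t"]
        has_vector_derivative_add[OF has_vector_derivative_const has_vector_derivative_id, of t "at 0"]
      by (simp add: o_def)
    from bounded_bilinear.has_vector_derivative[OF bounded_bilinear_matrix_vector_mult this
        has_vector_derivative_const[of y]]
    have "((\<lambda>s. A (t + s) *v y) has_vector_derivative affine_velocity A t x) (at 0)"
      by (simp add: affine_velocity_def velocity_gradient_def y_def matrix_vector_mul_assoc)
    then show ?thesis
      unfolding \<gamma>_def by (intro has_vector_derivative_Pair) (auto intro!: derivative_eq_intros)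
  qed
  ultimately have "(1, affine_velocity A t x) \<in> tangent_vectors (lateral_boundary A) (t, x)"
    unfolding tangent_vectors_def by auto
  with assms(2) show ?thesis
    unfolding normal_vectors_def orthogonal_comp_def orthogonal_def inner_commute[of \<eta>] by blast
qed

lemma pressure_boundary_condition:
  "(t, x) \<in> lateral_boundary A \<Longrightarrow> affine_pressure A t x = 0"
  by (simp add: mem_lateral_boundary affine_pressure_def)

lemma normal_deriv_pressure_neg:
  assumes "(t, x) \<in> lateral_boundary A" and "trace_sq A t > 0"
  shows "normal_deriv (fluid_domain A t) (affine_pressure A t) x < 0"
proof -
  define m where "m = transpose (B t) *v (B t *v x)"
  have x: "norm (B t *v x) = 1" using assms(1) by (simp add: mem_lateral_boundary)
  note normal = outward_unit_normal_ellipsoid[OF det_nonzero x, folded m_def]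
  define n where "n = m /\<^sub>R norm m"
  have n: "outward_unit_normal (fluid_domain A t) x = n"
    by (simp add: n_def fluid_domain_def normal(1))
  have "((\<lambda>s. affine_pressure A t (x + s *\<^sub>R n)) has_derivative
      (\<lambda>s. - c t * ((s *\<^sub>R n) \<bullet> m))) (at 0)"
  proof -
    have "((\<lambda>s. x + s *\<^sub>R n) has_derivative (\<lambda>s. s *\<^sub>R n)) (at 0)"
      by (auto intro!: derivative_eq_intros)
    moreover have "(affine_pressure A t has_derivative (\<lambda>v. - c t * (v \<bullet> m))) (at (x + 0 *\<^sub>R n))"
      using has_derivative_quadratic_profile[of "c t" "B t" x]
      by (simp add: affine_pressure_def[abs_def] m_def)
    ultimately show ?thesis by (rule has_derivative_compose)
  qed
  then have "((\<lambda>s. affine_pressure A t (x + s *\<^sub>R n)) has_real_derivative - c t * (n \<bullet> m)) (at 0)"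
    by (rule has_derivative_imp_has_field_derivative) simp
  then have "normal_deriv (fluid_domain A t) (affine_pressure A t) x = - c t * (n \<bullet> m)"
    by (simp add: normal_deriv_def n DERIV_imp_deriv)
  moreover have "n \<bullet> m > 0" using normal(2) by (simp add: n_def)
  moreover have "c t > 0" using assms(2) trace_inv_pos by simp
  ultimately show ?thesis using mult_pos_pos[of "c t" "n \<bullet> m"] by simp
qed

lemma normal_deriv_pressure_neg_if_curvature_pos:
  assumes "(t, x) \<in> lateral_boundary A" "kinetic_energy A 0 > 0" "curvature A t > 0"
  shows "normal_deriv (fluid_domain A t) (affine_pressure A t) x < 0"
proof (rule normal_deriv_pressure_neg[OF assms(1)])
  show "trace_sq A t > 0"
    using assms(2,3) trace_inv_pos[of t]
    by (simp add: curvature_def zero_less_divide_iff mult_less_0_iff)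
qed

end

theorem theorem2:
  fixes A0 A1 :: "real^3^3" and A :: "real \<Rightarrow> real^3^3"
  assumes "A0 \<in> SL3"
    and "trace (A1 ** matrix_inv A0) = 0"
    and "continuous_on UNIV A" and "\<And>t. A t \<in> SL3" and "C_infinity A"
    and "\<And>t. ddt (ddt A) t = (trace_sq A t / trace_inv A t) *\<^sub>R transpose (matrix_inv (A t))"
    and "A 0 = A0" and "ddt A 0 = A1"
  shows "solves_incompressible_Euler_on (fluid_spacetime A) (affine_velocity A) (affine_pressure A) \<and>
    (\<forall>(t, x)\<in>lateral_boundary A.
       (\<forall>\<eta>\<in>normal_vectors (lateral_boundary A) (t, x). \<eta> \<bullet> (1, affine_velocity A t x) = 0) \<and>
       affine_pressure A t x = 0) \<and>
    (kinetic_energy A 0 > 0 \<longrightarrow>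
      (\<forall>(t, x)\<in>lateral_boundary A.
         curvature A t > 0 \<longrightarrow> normal_deriv (fluid_domain A t) (affine_pressure A t) x < 0))"
proof -
  interpret affine_Euler_flow A
    using assms by unfold_locales (auto simp: SL3_def velocity_gradient_def)
  show ?thesis
    using solves_Euler kinematic_boundary_condition pressure_boundary_condition
      normal_deriv_pressure_neg_if_curvature_pos by auto
qed

end
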